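(* Let $\mathcal H$ be a real Hilbert space, let $A,B:\mathcal H\to2^{\mathcal H}$ be maximal monotone, let $C:\mathcal H\to\mathcal H$ be maximal monotone and single-valued, and suppose $x^\ast\in\mathrm{zer}(A+B+C)$. Let $B$ be $\mu_B$-strongly monotone, where $\mu_B=0$ is allowed. Given stepsizes $(\gamma_j)_{j\ge0}\subseteq(0,\infty)$ and $x_A^0\in\mathcal H$, set $x_B^0=J_{\gamma_0B}(x_A^0)$, $u_B^0=\gamma_0^{-1}(x_A^0-x_B^0)$, and for $k=1,2,\dots$ $$x_B^k=J_{\gamma_{k-1}B}(x_A^{k-1}+\gamma_{k-1}u_B^{k-1}),\quad u_B^k=\tfrac1{\gamma_{k-1}}(x_A^{k-1}+\gamma_{k-1}u_B^{k-1}-x_B^k),\quad x_A^k=J_{\gamma_kA}(x_B^k-\gamma_ku_B^k-\gamma_kCx_B^k).$$ 1. Suppose that $C$ is $\beta$-cocoercive ($\beta>0$) and $\mu_C$-strongly monotone, with $\mu_C\ge 0$ and $\mu_B+\mu_C>0$. Let $\eta\in(0,1)$, choose $\gamma_0\in(0,2\beta(1-\eta))$, and for all $k\ge0$ let $$\gamma_{k+1}:=\frac{-2\gamma_k^2\mu_C\eta+\sqrt{(2\gamma_k^2\mu_C\eta)^2+4(1+2\gamma_k\mu_B)\gamma_k^2}}{2(1+2\gamma_k\mu_B)}.$$ Then $\|x_B^k-x^\ast\|^2=O(1/(k+1)^2)$. 2. Suppose that $C$ is $L_C$-Lipschitz ($L_C>0$), but not necessarily strongly monotone or cocoercive, and that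 $\mu_B>0$. Let $\gamma_0\in(0,2\mu_B/L_C^2)$ and for all $k\ge0$ let $$\gamma_{k+1}:=\frac{\gamma_k}{\sqrt{1+2\gamma_k(\mu_B-\gamma_kL_C^2/2)}}.$$ Then $\|x_B^k-x^\ast\|^2=O(1/(k+1)^2)$.
   Context: $J_S:=(I_{\mathcal H}+S)^{-1}$ is the resolvent of a maximal monotone operator $S$; $\mathrm{zer}(S)=\{x:0\in Sx\}$. An operator $S$ is $\mu$-strongly monotone if $\langle x-y,u-v\rangle\ge\mu\|x-y\|^2$ for all $u\in Sx$, $v\in Sy$ ($\mu=0$ meaning just monotone). $C$ is $\beta$-cocoercive if $\langle Cx-Cy,x-y\rangle\ge\beta\|Cx-Cy\|^2$ for all $x,y$. *)

theory Defs
  imports "HOL-Analysis.Analysis" "HOL-Library.Landau_Symbols"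
begin

text \<open>A set-valued operator on a space \<open>'a\<close> is a function \<open>'a \<Rightarrow> 'a set\<close>; its graph is
  \<open>{(x, u). u \<in> S x}\<close>. The empty set is a legitimate value.\<close>

type_synonym 'a setop = "'a \<Rightarrow> 'a set"

definition op_of_fun :: "('a \<Rightarrow> 'a) \<Rightarrow> 'a setop" where
  "op_of_fun f = (\<lambda>x. {f x})"

definition op_add :: "'a::plus setop \<Rightarrow> 'a setop \<Rightarrow> 'a setop" where
  "op_add S T = (\<lambda>x. {u + v | u v. u \<in> S x \<and> v \<in> T x})"

definition op_scale :: "real \<Rightarrow> 'a::real_vector setop \<Rightarrow> 'a setop" where
  "op_scale c S = (\<lambda>x. (\<lambda>u. c *\<^sub>R u) ` S x)"

definition op_inverse :: "'a setop \<Rightarrow> 'a setop" where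
  "op_inverse S = (\<lambda>u. {x. u \<in> S x})"

definition zer :: "'a::zero setop \<Rightarrow> 'a set" where
  "zer S = {x. 0 \<in> S x}"

text \<open>The resolvent is the inverse of \<open>I + S\<close> as a set-valued operator. For a maximal monotone
  \<open>S\<close> on a Hilbert space each of its values is a singleton (Minty), so that \<open>y = J\<^sub>S z\<close>
  is expressed as \<open>y \<in> resolvent S z\<close>.\<close>

definition resolvent :: "'a::plus setop \<Rightarrow> 'a setop" where
  "resolvent S = op_inverse (op_add (op_of_fun (\<lambda>x. x)) S)"

definition strongly_monotone_op :: "real \<Rightarrow> 'a::real_inner setop \<Rightarrow> bool" where
  "strongly_monotone_op \<mu> S \<longleftrightarrow>
     (\<forall>x y. \<forall>u\<in>S x. \<forall>v\<in>S y. inner (x - y) (u - v) \<ge> \<mu> * (norm (x - y))\<^sup>2)"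

definition monotone_op :: "'a::real_inner setop \<Rightarrow> bool" where
  "monotone_op S \<longleftrightarrow> strongly_monotone_op 0 S"

definition maximal_monotone_op :: "'a::real_inner setop \<Rightarrow> bool" where
  "maximal_monotone_op S \<longleftrightarrow>
     monotone_op S \<and> (\<forall>T. monotone_op T \<and> (\<forall>x. S x \<subseteq> T x) \<longrightarrow> T = S)"

definition cocoercive :: "real \<Rightarrow> ('a::real_inner \<Rightarrow> 'a) \<Rightarrow> bool" where
  "cocoercive \<beta> C \<longleftrightarrow> (\<forall>x y. inner (C x - C y) (x - y) \<ge> \<beta> * (norm (C x - C y))\<^sup>2)"

end

theory Submission imports Defs begin

text \<open>Write \<open>a\<^sub>k = \<parallel>x\<^sub>B\<^sup>k - x*\<parallel>\<^sup>2\<close> and \<open>b\<^sub>k = \<parallel>u\<^sub>B\<^sup>k - u\<^sub>B*\<parallel>\<^sup>2\<close>, where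
  \<open>u\<^sub>A* + u\<^sub>B* + C x* = 0\<close> with \<open>u\<^sub>A* \<in> A x*\<close> and \<open>u\<^sub>B* \<in> B x*\<close>. Monotonicity gives
  \<open>(1 + 2 \<gamma>\<^sub>k \<mu>\<^sub>B) a\<^bsub>k+1\<^esub> + \<gamma>\<^sub>k\<^sup>2 b\<^bsub>k+1\<^esub> \<le> q\<^sub>k a\<^sub>k + \<gamma>\<^sub>k\<^sup>2 b\<^sub>k\<close>,
  where \<open>q\<^sub>k = 1 - 2 \<gamma>\<^sub>k \<eta> \<mu>\<^sub>C\<close> in the first part and \<open>q\<^sub>k = 1 + \<gamma>\<^sub>k\<^sup>2 L\<^sub>C\<^sup>2\<close> in the second.
  The stepsizes are chosen exactly so that
  \<open>(1 + 2 \<gamma>\<^sub>k \<mu>\<^sub>B) / \<gamma>\<^sub>k\<^sup>2 = q\<^bsub>k+1\<^esub> / \<gamma>\<^bsub>k+1\<^esub>\<^sup>2\<close>; hence \<open>q\<^sub>k a\<^sub>k / \<gamma>\<^sub>k\<^sup>2 + b\<^sub>k\<close> is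
  nonincreasing and \<open>a\<^bsub>k+1\<^esub> = O(\<gamma>\<^sub>k\<^sup>2)\<close>. The same relation makes \<open>1 / \<gamma>\<^sub>k\<close> grow linearly.\<close>

section \<open>Pointwise form of the inclusions and the one-step inequality\<close>

lemma mem_resolvent_op_scale_iff:
  "y \<in> resolvent (op_scale c S) z \<longleftrightarrow> (\<exists>u\<in>S y. z = y + c *\<^sub>R u)"
  by (auto simp: resolvent_def op_inverse_def op_add_def op_of_fun_def op_scale_def)

lemma mem_zer_three_sum_iff:
  fixes A B :: "'a::ab_group_add setop"
  shows "x \<in> zer (op_add (op_add A B) (op_of_fun C)) \<longleftrightarrow> (\<exists>u\<in>A x. \<exists>v\<in>B x. u + v + C x = 0)"
  by (fastforce simp: zer_def op_add_def op_of_fun_def)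

text \<open>In use, all letters are differences from the solution: \<open>a\<close>,
  \<open>y\<close>, \<open>p\<close> come from \<open>xB k\<close>, \<open>xA k\<close>,
  \<open>xB (Suc k)\<close>, while \<open>u\<close>, \<open>v\<close> come from \<open>B\<close>,
  \<open>w\<close> from \<open>A\<close> and \<open>d\<close> from \<open>C\<close>. The right side
  minus the left is exactly \<open>2 * \<gamma>\<close> times the two monotonicity gaps plus the
  squared norm of \<open>y - a + \<gamma> *\<^sub>R d\<close>.\<close>

lemma splitting_step:
  fixes a p y u v w d :: "'a::real_inner"
  assumes "\<gamma> > 0"
    and A_mono: "inner y w \<ge> 0"
    and B_mono: "inner p v \<ge> \<mu> * (norm p)\<^sup>2"
    and y_eq: "y = a - \<gamma> *\<^sub>R (w + u + d)"
    and p_eq: "p = y + \<gamma> *\<^sub>R (u - v)"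
  shows "(1 + 2 * \<gamma> * \<mu>) * (norm p)\<^sup>2 + \<gamma>\<^sup>2 * (norm v)\<^sup>2
    \<le> (norm a)\<^sup>2 + \<gamma>\<^sup>2 * (norm u)\<^sup>2 + \<gamma>\<^sup>2 * (norm d)\<^sup>2 - 2 * \<gamma> * inner a d"
proof -
  have a: "a = p + \<gamma> *\<^sub>R (w + v + d)" and y: "y = p + \<gamma> *\<^sub>R (v - u)"
    by (simp_all add: y_eq p_eq algebra_simps)
  have "(norm a)\<^sup>2 + \<gamma>\<^sup>2 * (norm u)\<^sup>2 + \<gamma>\<^sup>2 * (norm d)\<^sup>2 - 2 * \<gamma> * inner a d
      - ((1 + 2 * \<gamma> * \<mu>) * (norm p)\<^sup>2 + \<gamma>\<^sup>2 * (norm v)\<^sup>2)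
    = 2 * \<gamma> * inner y w + 2 * \<gamma> * (inner p v - \<mu> * (norm p)\<^sup>2)
      + (norm (p - a + \<gamma> *\<^sub>R (v - u) + \<gamma> *\<^sub>R d))\<^sup>2"
    unfolding a y power2_norm_eq_inner
    by (simp add: inner_add_left inner_add_right inner_diff_left inner_diff_right
        inner_commute power2_eq_square algebra_simps)
  also have "\<dots> \<ge> 0"
    using assms by (intro add_nonneg_nonneg mult_nonneg_nonneg) auto
  finally show ?thesis
    by simp
qed

text \<open>Once \<open>c \<le> m / 2\<close> and \<open>c \<le> s k\<close>, the cost
  \<open>2 * c * s k + c\<^sup>2\<close> of moving from \<open>s k\<close> to \<open>s k + c\<close>
  does not exceed the available increase \<open>2 * m * s k\<close> of the square. Used with
  \<open>s k = 1 / \<gamma> k\<close>.\<close>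

lemma linear_growth:
  fixes s :: "nat \<Rightarrow> real"
  assumes pos: "\<And>k. s k > 0" and "m > 0"
    and step: "\<And>k. (s (Suc k))\<^sup>2 \<ge> (s k)\<^sup>2 + 2 * m * s k"
  obtains c where "c > 0" "\<And>k. s k \<ge> c * (real k + 1)"
proof
  define c where "c = min (s 0) (m / 2)"
  show "c > 0"
    using pos[of 0] \<open>m > 0\<close> by (simp add: c_def)
  show "s k \<ge> c * (real k + 1)" for k
  proof (induction k)
    case 0
    show ?case by (simp add: c_def)
  next
    case (Suc k)
    have "c * 1 \<le> c * (real k + 1)"
      using \<open>c > 0\<close> by (intro mult_left_mono) auto
    with Suc.IH have "c \<le> s k" by simp
    then have "c * c \<le> c * s k"
      using \<open>c > 0\<close> by simp
    moreover have "2 * c * s k \<le> m * s k"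
      using pos[of k] by (intro mult_right_mono) (auto simp: c_def)
    moreover have "c * s k \<ge> 0"
      using \<open>c > 0\<close> pos[of k] by simp
    ultimately have "(s k + c)\<^sup>2 \<le> (s k)\<^sup>2 + 2 * m * s k"
      by (simp add: power2_eq_square algebra_simps)
    with step[of k] have "(s k + c)\<^sup>2 \<le> (s (Suc k))\<^sup>2" by linarith
    then have "s k + c \<le> s (Suc k)"
      using pos[of "Suc k"] by (auto intro: power2_le_imp_le)
    with Suc.IH show ?case by (simp add: algebra_simps)
  qed
qed

text \<open>Shared by both claims, which differ in \<open>q\<close> and \<open>m\<close>. Descent
  starts at index 1 because \<open>xA 0\<close> is a free starting point, not a resolvent value of
  \<open>A\<close>.\<close>

lemma rate_of_descent:
  fixes \<gamma> a b q :: "nat \<Rightarrow> real"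
  assumes \<gamma>: "\<And>k. \<gamma> k > 0" and "\<mu> \<ge> 0" and "m > 0"
    and nonneg: "\<And>k. a k \<ge> 0" "\<And>k. b k \<ge> 0"
    and descent: "\<And>k. k \<ge> 1 \<Longrightarrow>
      (1 + 2 * \<gamma> k * \<mu>) * a (Suc k) + (\<gamma> k)\<^sup>2 * b (Suc k) \<le> q k * a k + (\<gamma> k)\<^sup>2 * b k"
    and weights: "\<And>k. q (Suc k) / (\<gamma> (Suc k))\<^sup>2 \<le> (1 + 2 * \<gamma> k * \<mu>) / (\<gamma> k)\<^sup>2"
    and growth: "\<And>k. (1 / \<gamma> (Suc k))\<^sup>2 \<ge> (1 / \<gamma> k)\<^sup>2 + 2 * m * (1 / \<gamma> k)"
  shows "a \<in> O(\<lambda>k. 1 / (real k + 1)\<^sup>2)"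
proof -
  define V where "V k = q k / (\<gamma> k)\<^sup>2 * a k + b k" for k
  have step: "(1 + 2 * \<gamma> k * \<mu>) / (\<gamma> k)\<^sup>2 * a (Suc k) + b (Suc k) \<le> V k" if "k \<ge> 1" for k
  proof -
    have "((1 + 2 * \<gamma> k * \<mu>) * a (Suc k) + (\<gamma> k)\<^sup>2 * b (Suc k)) / (\<gamma> k)\<^sup>2
      \<le> (q k * a k + (\<gamma> k)\<^sup>2 * b k) / (\<gamma> k)\<^sup>2"
      using descent[OF that] by (rule divide_right_mono) simp
    moreover have "(x + (\<gamma> k)\<^sup>2 * y) / (\<gamma> k)\<^sup>2 = x / (\<gamma> k)\<^sup>2 + y" for x y
      using \<gamma>[of k] by (simp add: add_divide_distrib)
    ultimately show ?thesis
      by (simp add: V_def)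
  qed
  have V_Suc: "V (Suc k) \<le> V k" if "k \<ge> 1" for k
    using mult_right_mono[OF weights nonneg(1), of k "Suc k"] step[OF that]
    by (simp add: V_def)
  have V_le: "V k \<le> V 1" if "k \<ge> 1" for k
    using that by (induction k rule: dec_induct) (use V_Suc order_trans in blast)+
  obtain c where "c > 0" and c: "\<And>k. 1 / \<gamma> k \<ge> c * (real k + 1)"
    using linear_growth[of "\<lambda>k. 1 / \<gamma> k" m] \<gamma> \<open>m > 0\<close> growth by auto
  \<comment> \<open>\<open>a k\<close> is controlled by the step at \<open>j = k - 1\<close>, which
    must be at least 1. The factor 4 comes from
    \<open>real j + 1 = real k \<ge> (real k + 1) / 2\<close>.\<close>
  have bound: "norm (a k) \<le> 4 * V 1 / c\<^sup>2 * norm (1 / (real k + 1)\<^sup>2)" if "k \<ge> 2" for k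
  proof -
    obtain j where k: "k = Suc j" and j: "j \<ge> 1"
      using \<open>k \<ge> 2\<close> by (cases k) auto
    have "c * ((real k + 1) / 2) \<le> c * (real j + 1)"
      using \<open>c > 0\<close> k by (intro mult_left_mono) auto
    also have "\<dots> \<le> 1 / \<gamma> j" by (rule c)
    finally have "(c * ((real k + 1) / 2))\<^sup>2 \<le> (1 / \<gamma> j)\<^sup>2"
      using \<open>c > 0\<close> by (intro power_mono) auto
    also have "\<dots> \<le> (1 + 2 * \<gamma> j * \<mu>) / (\<gamma> j)\<^sup>2"
      using \<gamma>[of j] \<open>\<mu> \<ge> 0\<close> by (simp add: power_divide divide_right_mono)
    finally have "(c * ((real k + 1) / 2))\<^sup>2 * a k \<le> (1 + 2 * \<gamma> j * \<mu>) / (\<gamma> j)\<^sup>2 * a k"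
      using nonneg(1) by (rule mult_right_mono)
    also have "\<dots> \<le> V 1"
      using step[OF j] V_le[OF j] nonneg(2)[of k] k by simp
    finally have "a k \<le> V 1 / (c * ((real k + 1) / 2))\<^sup>2"
      using \<open>c > 0\<close> by (simp add: pos_le_divide_eq mult.commute)
    also have "\<dots> = 4 * V 1 / c\<^sup>2 * (1 / (real k + 1)\<^sup>2)"
      by (simp add: power_mult_distrib power_divide)
    finally show ?thesis
      using nonneg(1)[of k] by simp
  qed
  show ?thesis
    by (rule bigoI[where c = "4 * V 1 / c\<^sup>2"])
      (use bound in \<open>auto simp: eventually_at_top_linorder\<close>)
qed

lemma inverse_square_mono_antitone:
  fixes \<gamma> :: "nat \<Rightarrow> real"
  assumes \<gamma>: "\<And>k. \<gamma> k > 0" and le: "\<And>k. (1 / \<gamma> k)\<^sup>2 \<le> (1 / \<gamma> (Suc k))\<^sup>2"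
  shows "\<gamma> k \<le> \<gamma> 0"
proof -
  have "\<gamma> (Suc k) \<le> \<gamma> k" for k
    using power2_le_imp_le[OF le[of k]] \<gamma>[of k] \<gamma>[of "Suc k"] by (simp add: field_simps)
  then show ?thesis
    using lift_Suc_antimono_le[of \<gamma> 0 k] by simp
qed

text \<open>\<open>h\<close> is the root with the plus sign; isolating the square root and squaring
  recovers the equation. The stepsize rule has
  \<open>e = 2 * (\<gamma> k)\<^sup>2 * \<mu>C * \<eta>\<close>.\<close>

lemma stepsize_quadratic:
  fixes g e \<mu> :: real
  assumes "g > 0" "\<mu> \<ge> 0"
    and h: "h = (- e + sqrt (e\<^sup>2 + 4 * (1 + 2 * g * \<mu>) * g\<^sup>2)) / (2 * (1 + 2 * g * \<mu>))"
  shows "(1 + 2 * g * \<mu>) * h\<^sup>2 + e * h = g\<^sup>2"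
proof -
  define p where "p = 1 + 2 * g * \<mu>"
  have p: "p > 0"
    using assms by (simp add: p_def add_pos_nonneg)
  have "2 * p * h + e = sqrt (e\<^sup>2 + 4 * p * g\<^sup>2)"
    using p by (simp add: h p_def[symmetric])
  then have "(2 * p * h + e)\<^sup>2 = e\<^sup>2 + 4 * p * g\<^sup>2"
    using p by simp
  then have "4 * p * (p * h\<^sup>2 + e * h) = 4 * p * g\<^sup>2"
    by (simp add: power2_eq_square algebra_simps)
  with p show ?thesis
    by (simp add: p_def)
qed

theorem theorem1p2:
  fixes A B :: "'h::{real_inner, complete_space} \<Rightarrow> 'h set"
    and C :: "'h \<Rightarrow> 'h"
    and xstar :: 'h
    and \<mu>B :: real
    and \<gamma> :: "nat \<Rightarrow> real"
    and xA xB uB :: "nat \<Rightarrow> 'h"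
  assumes A: "maximal_monotone_op A"
    and B: "maximal_monotone_op B"
    and C: "maximal_monotone_op (op_of_fun C)"
    and xstar: "xstar \<in> zer (op_add (op_add A B) (op_of_fun C))"
    and \<mu>B: "\<mu>B \<ge> 0" "strongly_monotone_op \<mu>B B"
    and \<gamma>_pos: "\<And>j. \<gamma> j > 0"
    and xB_0: "xB 0 \<in> resolvent (op_scale (\<gamma> 0) B) (xA 0)"
    and uB_0: "uB 0 = inverse (\<gamma> 0) *\<^sub>R (xA 0 - xB 0)"
    and xB_k: "\<And>k. k \<ge> 1 \<Longrightarrow>
       xB k \<in> resolvent (op_scale (\<gamma> (k - 1)) B) (xA (k - 1) + \<gamma> (k - 1) *\<^sub>R uB (k - 1))"
    and uB_k: "\<And>k. k \<ge> 1 \<Longrightarrow>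
       uB k = (1 / \<gamma> (k - 1)) *\<^sub>R (xA (k - 1) + \<gamma> (k - 1) *\<^sub>R uB (k - 1) - xB k)"
    and xA_k: "\<And>k. k \<ge> 1 \<Longrightarrow>
       xA k \<in> resolvent (op_scale (\<gamma> k) A) (xB k - \<gamma> k *\<^sub>R uB k - \<gamma> k *\<^sub>R C (xB k))"
  shows "(\<forall>\<beta> \<mu>C \<eta> :: real.
            \<beta> > 0 \<and> cocoercive \<beta> C \<and>
            \<mu>C \<ge> 0 \<and> strongly_monotone_op \<mu>C (op_of_fun C) \<and>
            \<mu>B + \<mu>C > 0 \<and>
            \<eta> \<in> {0<..<1} \<and>
            \<gamma> 0 \<in> {0<..<2 * \<beta> * (1 - \<eta>)} \<and>
            (\<forall>k. \<gamma> (k + 1) =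
               (- 2 * (\<gamma> k)\<^sup>2 * \<mu>C * \<eta>
                  + sqrt ((2 * (\<gamma> k)\<^sup>2 * \<mu>C * \<eta>)\<^sup>2 + 4 * (1 + 2 * \<gamma> k * \<mu>B) * (\<gamma> k)\<^sup>2))
               / (2 * (1 + 2 * \<gamma> k * \<mu>B)))
            \<longrightarrow> (\<lambda>k. (norm (xB k - xstar))\<^sup>2) \<in> O(\<lambda>k. 1 / (real k + 1)\<^sup>2))
       \<and> (\<forall>LC :: real.
            LC > 0 \<and> LC-lipschitz_on UNIV C \<and>
            \<mu>B > 0 \<and>
            \<gamma> 0 \<in> {0<..<2 * \<mu>B / LC\<^sup>2} \<and>
            (\<forall>k. \<gamma> (k + 1) =
               \<gamma> k / sqrt (1 + 2 * \<gamma> k * (\<mu>B - \<gamma> k * LC\<^sup>2 / 2)))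
            \<longrightarrow> (\<lambda>k. (norm (xB k - xstar))\<^sup>2) \<in> O(\<lambda>k. 1 / (real k + 1)\<^sup>2))"
proof -
  obtain uA' uB' where uA': "uA' \<in> A xstar" and uB': "uB' \<in> B xstar"
    and sum0: "uA' + uB' + C xstar = 0"
    using xstar by (auto simp: mem_zer_three_sum_iff)
  define a b D where "a k = (norm (xB k - xstar))\<^sup>2" and "b k = (norm (uB k - uB'))\<^sup>2"
    and "D k = C (xB k) - C xstar" for k
  \<comment> \<open>The formula for \<open>uB k\<close> solves the resolvent equation for its
    selection from \<open>B\<close>, so the two coincide.\<close>
  have uB: "uB k \<in> B (xB k)" and xB: "xB k + \<gamma> (k - 1) *\<^sub>R uB k = xA (k - 1) + \<gamma> (k - 1) *\<^sub>R uB (k - 1)"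
    if k: "k \<ge> 1" for k
  proof -
    obtain u where u: "u \<in> B (xB k)"
      "xA (k - 1) + \<gamma> (k - 1) *\<^sub>R uB (k - 1) = xB k + \<gamma> (k - 1) *\<^sub>R u"
      using xB_k[OF k] by (auto simp: mem_resolvent_op_scale_iff)
    moreover have "uB k = u"
      unfolding uB_k[OF k] u(2) using \<gamma>_pos[of "k - 1"] by simp
    ultimately show "uB k \<in> B (xB k)"
      "xB k + \<gamma> (k - 1) *\<^sub>R uB k = xA (k - 1) + \<gamma> (k - 1) *\<^sub>R uB (k - 1)"
      by simp_all
  qed
  have step: "(1 + 2 * \<gamma> k * \<mu>B) * a (Suc k) + (\<gamma> k)\<^sup>2 * b (Suc k)
    \<le> a k + (\<gamma> k)\<^sup>2 * b k + (\<gamma> k)\<^sup>2 * (norm (D k))\<^sup>2 - 2 * \<gamma> k * inner (xB k - xstar) (D k)"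
    if k: "k \<ge> 1" for k
  proof -
    obtain w where w: "w \<in> A (xA k)" and xA: "xB k - \<gamma> k *\<^sub>R uB k - \<gamma> k *\<^sub>R C (xB k) = xA k + \<gamma> k *\<^sub>R w"
      using xA_k[OF k] by (auto simp: mem_resolvent_op_scale_iff)
    show ?thesis
      unfolding a_def b_def
    proof (rule splitting_step[OF \<gamma>_pos])
      show "inner (xA k - xstar) (w - uA') \<ge> 0"
        using A w uA' by (fastforce simp: maximal_monotone_op_def monotone_op_def strongly_monotone_op_def)
      show "inner (xB (Suc k) - xstar) (uB (Suc k) - uB') \<ge> \<mu>B * (norm (xB (Suc k) - xstar))\<^sup>2"
        using \<mu>B(2) uB[of "Suc k"] uB' by (auto simp: strongly_monotone_op_def)
      \<comment> \<open>Subtracting the optimality condition, which is zero, centers the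
        forward-backward step at the solution.\<close>
      have "w - uA' + (uB k - uB') + D k = w + uB k + C (xB k) - (uA' + uB' + C xstar)"
        by (simp add: D_def)
      also have "\<dots> = w + uB k + C (xB k)"
        by (simp add: sum0)
      finally show "xA k - xstar = xB k - xstar - \<gamma> k *\<^sub>R (w - uA' + (uB k - uB') + D k)"
        using xA by (simp add: algebra_simps)
      show "xB (Suc k) - xstar = xA k - xstar + \<gamma> k *\<^sub>R (uB k - uB' - (uB (Suc k) - uB'))"
        using xB[of "Suc k"] by (simp add: algebra_simps)
    qed
  qed
  have nonneg: "a k \<ge> 0" "b k \<ge> 0" for k
    by (simp_all add: a_def b_def)

  \<comment> \<open>Cocoercive \<open>C\<close>, with \<open>B\<close> or \<open>C\<close> strongly
    monotone\<close>
  have part1: "a \<in> O(\<lambda>k. 1 / (real k + 1)\<^sup>2)"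
    if "\<beta> > 0" and coco: "cocoercive \<beta> C" and "\<mu>C \<ge> 0"
      and C_strong: "strongly_monotone_op \<mu>C (op_of_fun C)" and "\<mu>B + \<mu>C > 0"
      and \<eta>: "0 < \<eta>" "\<eta> < 1" and \<gamma>0: "\<gamma> 0 < 2 * \<beta> * (1 - \<eta>)"
      and rec: "\<And>k. \<gamma> (Suc k) =
         (- (2 * (\<gamma> k)\<^sup>2 * \<mu>C * \<eta>)
            + sqrt ((2 * (\<gamma> k)\<^sup>2 * \<mu>C * \<eta>)\<^sup>2 + 4 * (1 + 2 * \<gamma> k * \<mu>B) * (\<gamma> k)\<^sup>2))
         / (2 * (1 + 2 * \<gamma> k * \<mu>B))"
    for \<beta> \<mu>C \<eta>
  proof -
    have quad: "(1 + 2 * \<gamma> k * \<mu>B) * (\<gamma> (Suc k))\<^sup>2 = (\<gamma> k)\<^sup>2 * (1 - 2 * \<gamma> (Suc k) * \<eta> * \<mu>C)" for k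
      using stepsize_quadratic[OF \<gamma>_pos \<mu>B(1) rec, of k] by (simp add: algebra_simps)
    have weights: "(1 - 2 * \<gamma> (Suc k) * \<eta> * \<mu>C) / (\<gamma> (Suc k))\<^sup>2 = (1 + 2 * \<gamma> k * \<mu>B) / (\<gamma> k)\<^sup>2" for k
      using quad[of k] \<gamma>_pos[of k] \<gamma>_pos[of "Suc k"] by (simp add: frac_eq_eq mult.commute)
    \<comment> \<open>The recursion for \<open>1 / \<gamma> k\<close> is implicit: its last term
      carries the new index. Monotonicity then lets \<open>growth\<close> replace that index by
      \<open>k\<close>.\<close>
    have s: "(1 / \<gamma> (Suc k))\<^sup>2 = (1 / \<gamma> k)\<^sup>2 + 2 * \<mu>B * (1 / \<gamma> k) + 2 * (\<eta> * \<mu>C) * (1 / \<gamma> (Suc k))" for k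
      using weights[of k] \<gamma>_pos[of k] \<gamma>_pos[of "Suc k"]
      by (simp add: power_divide diff_divide_distrib add_divide_distrib power2_eq_square)
    have mono: "(1 / \<gamma> k)\<^sup>2 \<le> (1 / \<gamma> (Suc k))\<^sup>2" for k
      unfolding s using \<mu>B(1) \<open>\<mu>C \<ge> 0\<close> \<eta> \<gamma>_pos[of k] \<gamma>_pos[of "Suc k"] by simp
    have growth: "(1 / \<gamma> k)\<^sup>2 + 2 * (\<mu>B + \<eta> * \<mu>C) * (1 / \<gamma> k) \<le> (1 / \<gamma> (Suc k))\<^sup>2" for k
    proof -
      have "1 / \<gamma> k \<le> 1 / \<gamma> (Suc k)"
        using power2_le_imp_le[OF mono[of k]] \<gamma>_pos[of "Suc k"] by simp
      then have "2 * (\<eta> * \<mu>C) * (1 / \<gamma> k) \<le> 2 * (\<eta> * \<mu>C) * (1 / \<gamma> (Suc k))"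
        using \<open>\<mu>C \<ge> 0\<close> \<eta> by (intro mult_left_mono) auto
      with s[of k] show ?thesis by (simp add: algebra_simps)
    qed
    have m: "\<mu>B + \<eta> * \<mu>C > 0"
    proof (cases "\<mu>C = 0")
      case True
      with \<open>\<mu>B + \<mu>C > 0\<close> show ?thesis by simp
    next
      case False
      with \<open>\<mu>C \<ge> 0\<close> \<eta> \<mu>B(1) show ?thesis by (simp add: add_nonneg_pos)
    qed
    have descent: "(1 + 2 * \<gamma> k * \<mu>B) * a (Suc k) + (\<gamma> k)\<^sup>2 * b (Suc k)
      \<le> (1 - 2 * \<gamma> k * \<eta> * \<mu>C) * a k + (\<gamma> k)\<^sup>2 * b k" if k: "k \<ge> 1" for k
    proof -
      let ?i = "inner (xB k - xstar) (D k)"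
      have "?i \<ge> \<mu>C * a k"
        using C_strong by (auto simp: strongly_monotone_op_def op_of_fun_def a_def D_def)
      moreover have "?i \<ge> \<beta> * (norm (D k))\<^sup>2"
        using coco by (auto simp: cocoercive_def D_def inner_commute)
      \<comment> \<open>The inner product is split: the share \<open>\<eta>\<close> uses strong
        monotonicity to produce the contraction, the share \<open>1 - \<eta>\<close> uses
        cocoercivity to absorb \<open>(\<gamma> k)\<^sup>2 * (norm (D k))\<^sup>2\<close>. The
        latter requires \<open>\<gamma> k \<le> 2 * \<beta> * (1 - \<eta>)\<close>, inherited from
        \<open>\<gamma> 0\<close>.\<close>
      ultimately have "\<eta> * (\<mu>C * a k) + (1 - \<eta>) * (\<beta> * (norm (D k))\<^sup>2) \<le> \<eta> * ?i + (1 - \<eta>) * ?i"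
        using \<eta> by (intro add_mono mult_left_mono) auto
      also have "\<dots> = ?i"
        by (simp add: algebra_simps)
      finally have i: "2 * \<gamma> k * (\<eta> * (\<mu>C * a k) + (1 - \<eta>) * (\<beta> * (norm (D k))\<^sup>2)) \<le> 2 * \<gamma> k * ?i"
        using \<gamma>_pos[of k] by simp
      have "\<gamma> k \<le> 2 * \<beta> * (1 - \<eta>)"
        using inverse_square_mono_antitone[of \<gamma> k, OF \<gamma>_pos mono] \<gamma>0 by simp
      then have "\<gamma> k * (\<gamma> k * (norm (D k))\<^sup>2) \<le> 2 * \<beta> * (1 - \<eta>) * (\<gamma> k * (norm (D k))\<^sup>2)"
        using \<gamma>_pos[of k] by (intro mult_right_mono) auto
      then have "(\<gamma> k)\<^sup>2 * (norm (D k))\<^sup>2 \<le> 2 * \<gamma> k * ((1 - \<eta>) * (\<beta> * (norm (D k))\<^sup>2))"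
        by (simp add: power2_eq_square algebra_simps)
      with i step[OF k] show ?thesis
        by (simp add: algebra_simps)
    qed
    show ?thesis
      by (rule rate_of_descent[where \<gamma> = \<gamma> and a = a and b = b and q = "\<lambda>k. 1 - 2 * \<gamma> k * \<eta> * \<mu>C",
            OF \<gamma>_pos \<mu>B(1) m nonneg descent eq_refl[OF weights] growth])
  qed

  \<comment> \<open>Lipschitz \<open>C\<close> and strongly monotone \<open>B\<close>\<close>
  have part2: "a \<in> O(\<lambda>k. 1 / (real k + 1)\<^sup>2)"
    if "LC > 0" and lip: "LC-lipschitz_on UNIV C" and "\<mu>B > 0" and \<gamma>0: "\<gamma> 0 < 2 * \<mu>B / LC\<^sup>2"
      and rec: "\<And>k. \<gamma> (Suc k) = \<gamma> k / sqrt (1 + 2 * \<gamma> k * (\<mu>B - \<gamma> k * LC\<^sup>2 / 2))"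
    for LC
  proof -
    have s: "(1 / \<gamma> (Suc k))\<^sup>2 = (1 / \<gamma> k)\<^sup>2 + 2 * \<mu>B * (1 / \<gamma> k) - LC\<^sup>2" for k
    proof -
      define r where "r = 1 + 2 * \<gamma> k * (\<mu>B - \<gamma> k * LC\<^sup>2 / 2)"
      \<comment> \<open>Positivity of the quotient defining \<open>\<gamma> (Suc k)\<close> forces
        this: \<open>sqrt\<close> is negative on negative arguments, and division by zero gives
        zero.\<close>
      have "sqrt r > 0"
        using \<gamma>_pos[of "Suc k"] \<gamma>_pos[of k] rec[of k] by (simp add: r_def zero_less_divide_iff)
      then have "(1 / \<gamma> (Suc k))\<^sup>2 = r / (\<gamma> k)\<^sup>2"
        using rec[of k] by (simp add: r_def[symmetric] power_divide)
      also have "\<dots> = (1 / \<gamma> k)\<^sup>2 + 2 * \<mu>B * (1 / \<gamma> k) - LC\<^sup>2"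
        using \<gamma>_pos[of k] by (simp add: r_def field_simps power2_eq_square)
      finally show ?thesis .
    qed
    \<comment> \<open>What remains of \<open>\<mu>B\<close> after the Lipschitz loss at the largest
      stepsize; the bound on \<open>\<gamma> 0\<close> makes it positive.\<close>
    define m where "m = \<mu>B - LC\<^sup>2 * \<gamma> 0 / 2"
    have m: "m > 0"
      using \<gamma>0 \<open>LC > 0\<close> by (simp add: m_def field_simps)
    have grow: "(1 / \<gamma> k)\<^sup>2 + 2 * m * (1 / \<gamma> k) \<le> (1 / \<gamma> (Suc k))\<^sup>2" if "\<gamma> k \<le> \<gamma> 0" for k
    proof -
      \<comment> \<open>The constant loss in \<open>s\<close> is charged to the term linear in
        \<open>1 / \<gamma> k\<close>.\<close>
      have "LC\<^sup>2 * 1 \<le> LC\<^sup>2 * (\<gamma> 0 / \<gamma> k)"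
        using that \<gamma>_pos[of k] by (intro mult_left_mono) auto
      then show ?thesis
        unfolding s by (simp add: m_def diff_divide_distrib algebra_simps)
    qed
    \<comment> \<open>Growth needs this bound and in turn preserves it, hence the induction.\<close>
    have le0: "\<gamma> k \<le> \<gamma> 0" for k
    proof (induction k)
      case (Suc k)
      have "(1 / \<gamma> k)\<^sup>2 \<le> (1 / \<gamma> (Suc k))\<^sup>2"
        using grow[OF Suc] m \<gamma>_pos[of k] by (smt (verit) divide_nonneg_pos mult_nonneg_nonneg)
      from power2_le_imp_le[OF this] have "\<gamma> (Suc k) \<le> \<gamma> k"
        using \<gamma>_pos[of k] \<gamma>_pos[of "Suc k"] by (simp add: field_simps)
      with Suc show ?case by simp
    qed simp
    have weights: "(1 + (\<gamma> (Suc k))\<^sup>2 * LC\<^sup>2) / (\<gamma> (Suc k))\<^sup>2 = (1 + 2 * \<gamma> k * \<mu>B) / (\<gamma> k)\<^sup>2" for k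
    proof -
      have "(1 + (\<gamma> (Suc k))\<^sup>2 * LC\<^sup>2) / (\<gamma> (Suc k))\<^sup>2 = (1 / \<gamma> (Suc k))\<^sup>2 + LC\<^sup>2"
        using \<gamma>_pos[of "Suc k"] by (simp add: add_divide_distrib power_divide)
      also have "\<dots> = (1 + 2 * \<gamma> k * \<mu>B) / (\<gamma> k)\<^sup>2"
        unfolding s using \<gamma>_pos[of k] by (simp add: field_simps power2_eq_square)
      finally show ?thesis .
    qed
    have descent: "(1 + 2 * \<gamma> k * \<mu>B) * a (Suc k) + (\<gamma> k)\<^sup>2 * b (Suc k)
      \<le> (1 + (\<gamma> k)\<^sup>2 * LC\<^sup>2) * a k + (\<gamma> k)\<^sup>2 * b k" if k: "k \<ge> 1" for k
    proof -
      \<comment> \<open>Here \<open>C\<close> contributes no contraction: monotonicity discards the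
        inner product, and the Lipschitz bound puts the remaining error into
        \<open>q\<close>.\<close>
      have "inner (xB k - xstar) (D k) \<ge> 0"
        using C by (auto simp: maximal_monotone_op_def monotone_op_def strongly_monotone_op_def
            op_of_fun_def D_def)
      then have "2 * \<gamma> k * inner (xB k - xstar) (D k) \<ge> 0"
        using \<gamma>_pos[of k] by simp
      moreover have "norm (D k) \<le> LC * norm (xB k - xstar)"
        using lipschitz_onD[OF lip, of "xB k" xstar] by (simp add: dist_norm D_def)
      then have "(norm (D k))\<^sup>2 \<le> LC\<^sup>2 * a k"
        unfolding a_def power_mult_distrib[symmetric] by (intro power_mono) auto
      then have "(\<gamma> k)\<^sup>2 * (norm (D k))\<^sup>2 \<le> (\<gamma> k)\<^sup>2 * (LC\<^sup>2 * a k)"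
        by (intro mult_left_mono) auto
      ultimately show ?thesis
        using step[OF k] by (simp add: algebra_simps)
    qed
    show ?thesis
      by (rule rate_of_descent[where \<gamma> = \<gamma> and a = a and b = b and q = "\<lambda>k. 1 + (\<gamma> k)\<^sup>2 * LC\<^sup>2",
            OF \<gamma>_pos \<mu>B(1) m nonneg descent eq_refl[OF weights] grow[OF le0]])
  qed
  show ?thesis
    using part1 part2 by (fold a_def) auto
qed

end
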